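(* Let $X$ be a real Banach space with continuous dual $X^*$, and let $A\colon X\rightrightarrows X^*$ be a maximally monotone operator. If $A$ is of type Fitzpatrick-Phelps (FP), then $A$ is of type negative infimum (NI).
   Context: $X$ is a real Banach space, $X^*$ its continuous dual, $X^{**}$ its bidual; $\langle\cdot,\cdot\rangle$ denotes the duality pairings (between $X$ and $X^*$, and between $X^*$ and $X^{**}$, written in either order), and $X$ is identified with its canonical image in $X^{**}$. A set-valued operator $A\colon X\rightrightarrows X^*$ assigns to each $x\in X$ a (possibly empty) subset $Ax\subseteq X^*$. Its graph is $\operatorname{gra}A=\{(x,x^* )\in X\times X^* \mid x^*\in Ax\}$ and its range is $\operatorname{ran}A=\bigcup_{x\in X}Ax$. $A$ is monotone if $\langle x-y,x^*-y^*\rangle\ge 0$ for all $(x,x^* ),(y,y^* )\in\operatorname{gra}A$; a subset of $X\times X^*$ is called monotone if it is the graph of a monotone operator. $A$ is maximally monotone if it is monotone and admits no proper monotone extension (i.e. no monotone subset of $X\times X^*$ properly contains $\operatorname{gra}A$). A point $(x,x^* )\in X\times X^*$ is monotonically related to a monotone set $G\subseteq X\times X^*$ if $\{(x,x^* )\}\cup G$ is monotone. Let $A$ be maximally monotone. Type (FP): $A$ is of type (FP) if whenever $U$ is an open (in norm) convex subset of $X^*$ with $U\cap\operatorname{ran}A\neq\varnothing$, $x^*\in U$, and $(x,x^* )\in X\times X^*$ is monotonically related to $\operatorname{gra}A\cap(X\times U)$, it follows that $(x,x^* )\in\operatorname{gra}A$. Type (NI): $A$ is of type (NI) if $$\sup_{(a,a^*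 )\in\operatorname{gra}A}\big(\langle a,x^*\rangle+\langle a^*,x^{**}\rangle-\langle a,a^*\rangle\big)\ge\langle x^{**},x^*\rangle\quad\text{for all }(x^{**},x^* )\in X^{**}\times X^*,$$ where the supremum is taken in the extended reals. *)

theory Defs
  imports "HOL-Analysis.Analysis"
begin

(* The space X is a type 'a of class banach, its continuous dual is the type of bounded linear
   functionals with the operator norm; the pairings are blinfun application. *)
type_synonym 'a dual = "'a \<Rightarrow>\<^sub>L real"

type_synonym 'a bidual = "'a dual dual"

definition gra :: "('a::real_normed_vector \<Rightarrow> 'a dual set) \<Rightarrow> ('a \<times> 'a dual) set"
  where "gra A = {(x, x'). x' \<in> A x}"

definition ran_op :: "('a::real_normed_vector \<Rightarrow> 'a dual set) \<Rightarrow> 'a dual set"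
  where "ran_op A = (\<Union>x. A x)"

definition monotone_set :: "('a::real_normed_vector \<times> 'a dual) set \<Rightarrow> bool"
  where "monotone_set G \<longleftrightarrow>
    (\<forall>(x, x') \<in> G. \<forall>(y, y') \<in> G. blinfun_apply (x' - y') (x - y) \<ge> 0)"

definition monotone_op :: "('a::real_normed_vector \<Rightarrow> 'a dual set) \<Rightarrow> bool"
  where "monotone_op A \<longleftrightarrow> monotone_set (gra A)"

definition maximally_monotone :: "('a::real_normed_vector \<Rightarrow> 'a dual set) \<Rightarrow> bool"
  where "maximally_monotone A \<longleftrightarrow>
    monotone_op A \<and> \<not> (\<exists>G. monotone_set G \<and> gra A \<subset> G)"

definition monotonically_related ::
    "'a::real_normed_vector \<times> 'a dual \<Rightarrow> ('a \<times> 'a dual) set \<Rightarrow> bool"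
  where "monotonically_related p G \<longleftrightarrow> monotone_set ({p} \<union> G)"

definition type_FP :: "('a::real_normed_vector \<Rightarrow> 'a dual set) \<Rightarrow> bool"
  where "type_FP A \<longleftrightarrow>
    (\<forall>U x x'. open U \<longrightarrow> convex U \<longrightarrow> U \<inter> ran_op A \<noteq> {} \<longrightarrow> x' \<in> U \<longrightarrow>
       monotonically_related (x, x') (gra A \<inter> (UNIV \<times> U)) \<longrightarrow> (x, x') \<in> gra A)"

definition type_NI :: "('a::real_normed_vector \<Rightarrow> 'a dual set) \<Rightarrow> bool"
  where "type_NI A \<longleftrightarrow>
    (\<forall>(x'' :: 'a bidual) (x' :: 'a dual).
       (SUP (a, a') \<in> gra A.
          ereal (blinfun_apply x' a + blinfun_apply x'' a' - blinfun_apply a' a))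
       \<ge> ereal (blinfun_apply x'' x'))"

end

theory Submission
  imports Defs
begin

text \<open>
  Suppose \<open>(f, p)\<close> violates (NI). Then some \<open>\<epsilon> > 0\<close> satisfies
  \<open>\<langle>a, a' - p\<rangle> \<ge> \<langle>f, a' - p\<rangle> + \<epsilon>\<close> on the graph of \<open>A\<close>. Fix \<open>q\<close> in the range of \<open>A\<close> and choose
  \<open>x\<close> in \<open>X\<close> with \<open>\<langle>x, q - p\<rangle> = \<langle>f, q - p\<rangle>\<close>. The open half-space
  \<open>U = {u. \<langle>x, u - p\<rangle> < \<langle>f, u - p\<rangle> + \<epsilon>}\<close> contains both \<open>p\<close> and \<open>q\<close>, and \<open>(x, p)\<close> is monotonically
  related to the part of the graph over \<open>U\<close>. So (FP) puts \<open>(x, p)\<close> in the graph, where the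
  inequality reads \<open>0 \<ge> \<epsilon>\<close>.
\<close>

text \<open>An empty graph would be properly extended by the monotone singleton at the
  origin.\<close>

lemma maximally_monotone_gra_nonempty:
  fixes A :: "'a::real_normed_vector \<Rightarrow> 'a dual set"
  assumes "maximally_monotone A"
  shows "gra A \<noteq> {}"
proof
  assume "gra A = {}"
  moreover have "monotone_set {(0 :: 'a, 0 :: 'a dual)}"
    by (simp add: monotone_set_def)
  ultimately show False
    using assms unfolding maximally_monotone_def by blast
qed

lemma monotonically_related_iff:
  assumes "monotone_set G"
  shows "monotonically_related (x, x') G \<longleftrightarrow>
    (\<forall>(a, a') \<in> G. blinfun_apply (a' - x') (a - x) \<ge> 0)"
proof -
  have "blinfun_apply (x' - a') (x - a) = blinfun_apply (a' - x') (a - x)" for a a'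
    by (simp add: blinfun.diff_left blinfun.diff_right)
  then show ?thesis
    using assms by (auto simp: monotonically_related_def monotone_set_def blinfun.zero_left)
qed

text \<open>A nonzero functional maps onto the reals, so rescaling any \<open>y\<close> outside its
  kernel hits the required value; for \<open>d = 0\<close> both sides vanish.\<close>

lemma bidual_eq_eval_at_point:
  fixes f :: "'a::real_normed_vector bidual" and d :: "'a dual"
  obtains x where "blinfun_apply d x = blinfun_apply f d"
proof (cases "d = 0")
  case True
  then show ?thesis using that by simp
next
  case False
  then obtain y where "blinfun_apply d y \<noteq> 0"
    by (metis blinfun_eqI zero_blinfun.rep_eq)
  then have "blinfun_apply d ((blinfun_apply f d / blinfun_apply d y) *\<^sub>R y) = blinfun_apply f d"
    by (simp add: blinfun.scaleR_right)
  then show ?thesis by (rule that)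
qed

theorem theorem3p1:
  fixes A :: "'a::banach \<Rightarrow> 'a dual set"
  assumes "maximally_monotone A"
    and "type_FP A"
  shows "type_NI A"
proof (rule ccontr)
  assume "\<not> type_NI A"
  then obtain f :: "'a bidual" and p :: "'a dual" where
    "(SUP (a, a') \<in> gra A. ereal (blinfun_apply p a + blinfun_apply f a' - blinfun_apply a' a))
      < ereal (blinfun_apply f p)"
    by (auto simp: type_NI_def not_le)
  \<comment> \<open>A real \<open>r\<close> strictly in between leaves the same margin \<epsilon> at
    every point of the graph.\<close>
  then obtain r where
    r: "(SUP (a, a') \<in> gra A. ereal (blinfun_apply p a + blinfun_apply f a' - blinfun_apply a' a))
      < ereal r" and "r < blinfun_apply f p"
    by (auto dest: ereal_dense2)
  define \<epsilon> where "\<epsilon> = blinfun_apply f p - r"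
  have "\<epsilon> > 0" using \<open>r < blinfun_apply f p\<close> by (simp add: \<epsilon>_def)
  have gap: "blinfun_apply (a' - p) a \<ge> blinfun_apply f (a' - p) + \<epsilon>" if "(a, a') \<in> gra A" for a a'
  proof -
    have "ereal (blinfun_apply p a + blinfun_apply f a' - blinfun_apply a' a) < ereal r"
      using le_less_trans[OF SUP_upper[OF that] r] by simp
    then show ?thesis
      by (simp add: \<epsilon>_def blinfun.diff_left blinfun.diff_right)
  qed
  obtain a\<^sub>0 q where q: "(a\<^sub>0, q) \<in> gra A"
    using maximally_monotone_gra_nonempty[OF assms(1)] by auto
  obtain x where x: "blinfun_apply (q - p) x = blinfun_apply f (q - p)"
    by (rule bidual_eq_eval_at_point)
  define U where "U = {u. blinfun_apply (u - p) x < blinfun_apply f (u - p) + \<epsilon>}"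
  have "open U"
    unfolding U_def by (intro open_Collect_less continuous_intros)
  moreover have "convex U"
  proof -
    have "linear (\<lambda>u. blinfun_apply u x - blinfun_apply f u)"
      by (intro linearI) (simp_all add: blinfun.add_left blinfun.add_right
          blinfun.scaleR_left blinfun.scaleR_right algebra_simps)
    moreover have "U = (\<lambda>u. blinfun_apply u x - blinfun_apply f u) -`
        {..< blinfun_apply p x - blinfun_apply f p + \<epsilon>}"
      by (auto simp: U_def blinfun.diff_left blinfun.diff_right)
    ultimately show ?thesis
      by (simp add: convex_linear_vimage)
  qed
  moreover have "U \<inter> ran_op A \<noteq> {}"
  proof -
    have "q \<in> U" using x \<open>\<epsilon> > 0\<close> by (simp add: U_def)
    moreover have "q \<in> ran_op A" using q by (auto simp: gra_def ran_op_def)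
    ultimately show ?thesis by blast
  qed
  moreover have "p \<in> U"
    using \<open>\<epsilon> > 0\<close> by (simp add: U_def blinfun.zero_left blinfun.zero_right)
  moreover have "monotonically_related (x, p) (gra A \<inter> (UNIV \<times> U))"
  proof -
    have "monotone_set (gra A \<inter> (UNIV \<times> U))"
      using assms(1) by (auto simp: maximally_monotone_def monotone_op_def monotone_set_def)
    \<comment> \<open>The threshold of \<open>U\<close> lies strictly above the value at
      \<open>x\<close> and, by \<open>gap\<close>, not above the value at \<open>a\<close>.\<close>
    moreover have "blinfun_apply (a' - p) (a - x) \<ge> 0" if "(a, a') \<in> gra A" "a' \<in> U" for a a'
      using gap[OF that(1)] that(2) by (simp add: U_def blinfun.diff_right)
    ultimately show ?thesis
      by (auto simp: monotonically_related_iff)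
  qed
  ultimately have "(x, p) \<in> gra A"
    using assms(2) unfolding type_FP_def by blast
  then show False
    using gap[of x p] \<open>\<epsilon> > 0\<close> by (simp add: blinfun.zero_left blinfun.zero_right)
qed

end
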